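(* Let $\phi:\mathbb{R}^n\to\mathbb{R}$ be convex and twice continuously differentiable. Assume that $\nabla\phi$ is Lipschitz-continuous with constant $L>0$, that the minimum value $\phi^*$ of $\phi$ is attained, and that there exists $\mu>0$ such that $\mu(\phi(z)-\phi^* )\le\frac12\|\nabla\phi(z)\|^2$ for all $z\in\mathbb{R}^n$. Given $\alpha\ge 3$ and $\beta>0$, let $\chi_{x_0}:[0,\infty)\to\mathbb{R}^n$ be the restarted trajectory (defined in the context) of the equation $\ddot x(t)+\frac{\alpha}{t}\dot x(t)+\nabla\phi(x(t))+\beta\nabla^2\phi(x(t))\dot x(t)=0$ from an initial point $x_0\in\mathbb{R}^n$. Then there exist constants $C,K>0$ such that $$\phi\big(\chi_{x_0}(t)\big)-\phi^*\le Ce^{-Kt}\big(\phi(x_0)-\phi^*\big)\le\frac{CL}{2}e^{-Kt}\,\mathrm{dist}\big(x_0,\mathrm{argmin}(\phi)\big)^2$$ for all $t>0$.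
   Context: For $z\in\mathbb{R}^n$, let $y_z$ be the solution of the equation $\ddot x(t)+\frac{\alpha}{t}\dot x(t)+\nabla\phi(x(t))+\beta\nabla^2\phi(x(t))\dot x(t)=0$ $(t>0)$ with $y_z(0)=z$, $\dot y_z(0)=0$, where a solution is a function in $C^2((0,+\infty);\mathbb{R}^n)\cap C^1([0,+\infty);\mathbb{R}^n)$ satisfying the initial conditions and the equation for every $t>0$ (such a solution exists and is unique). The restarting time is $$T(z)=\inf\Big\{t>0:\ \frac{d}{dt}\|\dot y_z(t)\|^2\le 0\Big\}.$$ Restarted trajectory $\chi_{x_0}$, defined inductively: (1) set $T_1=T(x_0)$, $S_1=T_1$, and $\chi_{x_0}(t)=y_{x_0}(t)$ for $t\in[0,S_1]$. (2) For $i\ge1$, having defined $\chi_{x_0}$ on $[0,S_i]$, set $x_i=\chi_{x_0}(S_i)$, $T_{i+1}=T(x_i)$, $S_{i+1}=S_i+T_{i+1}$, and $\chi_{x_0}(t)=y_{x_i}(t-S_i)$ for $t\in(S_i,S_{i+1}]$. If some $x_i\in\mathrm{argmin}(\phi)$ ($i\ge0$), the trajectory is taken constant equal to $x_i$ from time $S_i$ on (with $S_0=0$). Under the hypotheses, $0<\inf\{T(z):z\notin\mathrm{argmin}(\phi)\}\le\sup\{T(z):z\notin\mathrm{argmin}(\phi)\}<\infty$ (when $\mathrm{argmin}(\phi)\ne\mathbb{R}^n$), so $\chi_{x_0}$ is defined on all of $[0,\infty)$. *)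

theory Defs
  imports "HOL-Analysis.Analysis"
begin

definition grad :: "(real ^ 'n \<Rightarrow> real) \<Rightarrow> real ^ 'n \<Rightarrow> real ^ 'n" where
  "grad \<phi> x = (THE D. GDERIV \<phi> x :> D)"

definition hess :: "(real ^ 'n \<Rightarrow> real) \<Rightarrow> real ^ 'n \<Rightarrow> real ^ 'n ^ 'n" where
  "hess \<phi> x = jacobian (grad \<phi>) (at x)"

definition twice_continuously_differentiable :: "(real ^ 'n \<Rightarrow> real) \<Rightarrow> bool" where
  "twice_continuously_differentiable \<phi> \<longleftrightarrow>
     \<phi> differentiable_on UNIV \<and> grad \<phi> differentiable_on UNIV \<and> continuous_on UNIV (hess \<phi>)"

definition argmin_set :: "('a \<Rightarrow> real) \<Rightarrow> 'a set" where
  "argmin_set \<phi> = {z. is_arg_min \<phi> (\<lambda>_. True) z}"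

definition min_value :: "('a \<Rightarrow> real) \<Rightarrow> real" where
  "min_value \<phi> = (INF z. \<phi> z)"

(* Only meaningful for t \<ge> 0: one-sided derivative at t = 0, ordinary derivative at t > 0. *)
definition velocity :: "(real \<Rightarrow> real ^ 'n) \<Rightarrow> real \<Rightarrow> real ^ 'n" where
  "velocity y t = vector_derivative y (at t within {0..})"

definition acceleration :: "(real \<Rightarrow> real ^ 'n) \<Rightarrow> real \<Rightarrow> real ^ 'n" where
  "acceleration y t = vector_derivative (velocity y) (at t)"

(* The first two conjuncts say that y is C^1 on [0, \<infinity>), the third that it is C^2 on (0, \<infinity>).
   The values of y at negative times are unconstrained. *)
definition is_solution ::
    "(real ^ 'n \<Rightarrow> real) \<Rightarrow> real \<Rightarrow> real \<Rightarrow> real ^ 'n \<Rightarrow> (real \<Rightarrow> real ^ 'n) \<Rightarrow> bool" where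
  "is_solution \<phi> \<alpha> \<beta> z y \<longleftrightarrow>
     y differentiable_on {0..} \<and> continuous_on {0..} (velocity y) \<and>
     velocity y C1_differentiable_on {0<..} \<and>
     y 0 = z \<and> velocity y 0 = 0 \<and>
     (\<forall>t>0. acceleration y t + (\<alpha> / t) *\<^sub>R velocity y t + grad \<phi> (y t)
              + \<beta> *\<^sub>R (hess \<phi> (y t) *v velocity y t) = 0)"

definition restart_time :: "(real \<Rightarrow> real ^ 'n) \<Rightarrow> real" where
  "restart_time y = Inf {t. 0 < t \<and> deriv (\<lambda>s. (norm (velocity y s))\<^sup>2) t \<le> 0}"

text \<open>
  In the following, \<open>y z\<close> is the solution starting at \<open>z\<close>;
  \<open>restart_point y x0 i\<close> and \<open>restart_instant y x0 i\<close> are \<open>x\<^sub>i\<close> and \<open>S\<^sub>i\<close> (with \<open>S\<^sub>0 = 0\<close>).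
\<close>

primrec restart_point ::
    "(real ^ 'n \<Rightarrow> real \<Rightarrow> real ^ 'n) \<Rightarrow> real ^ 'n \<Rightarrow> nat \<Rightarrow> real ^ 'n" where
  "restart_point y x0 0 = x0"
| "restart_point y x0 (Suc i) =
     y (restart_point y x0 i) (restart_time (y (restart_point y x0 i)))"

primrec restart_instant ::
    "(real ^ 'n \<Rightarrow> real \<Rightarrow> real ^ 'n) \<Rightarrow> real ^ 'n \<Rightarrow> nat \<Rightarrow> real" where
  "restart_instant y x0 0 = 0"
| "restart_instant y x0 (Suc i) =
     restart_instant y x0 i + restart_time (y (restart_point y x0 i))"

(* The least i with t \<le> S_(i+1) is the index of the segment (S_i, S_(i+1)] containing t,
   or 0 if t = 0.  The first branch is the convention that the trajectory stays at the first
   restart point that is a minimizer. *)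
definition restarted_trajectory ::
    "(real ^ 'n \<Rightarrow> real) \<Rightarrow> (real ^ 'n \<Rightarrow> real \<Rightarrow> real ^ 'n) \<Rightarrow> real ^ 'n \<Rightarrow> real \<Rightarrow> real ^ 'n" where
  "restarted_trajectory \<phi> y x0 t =
     (if \<exists>i. restart_point y x0 i \<in> argmin_set \<phi> \<and> restart_instant y x0 i \<le> t
      then restart_point y x0
             (LEAST i. restart_point y x0 i \<in> argmin_set \<phi> \<and> restart_instant y x0 i \<le> t)
      else let i = (LEAST i. t \<le> restart_instant y x0 (Suc i))
           in y (restart_point y x0 i) (t - restart_instant y x0 i))"

end

theory Submission
  imports Defs
begin

text \<open>
  Write \<open>g = \<nabla>\<phi>(z)\<close>. Comparing the equation with its linearisation at \<open>t = 0\<close> gives, on a window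
  \<open>[0, \<tau>]\<close> depending only on \<open>L\<close> and \<open>\<beta>\<close>, that \<open>x'(t) \<approx> - t g / (\<alpha> + 1)\<close> and
  \<open>x''(t) \<approx> - g / (\<alpha> + 1)\<close>: the speed increases there and is at least \<open>t |g| / (2 (\<alpha> + 1))\<close>,
  so the restarting time is at least \<open>\<tau>\<close>. While the speed increases,
  \<open>(\<phi> \<circ> x)' \<le> - (\<alpha> / t) |x'|\<^sup>2\<close>. On \<open>[0, \<tau>]\<close> this makes \<open>\<phi>\<close> drop by a multiple of \<open>|g|\<^sup>2\<close>, hence
  of \<open>\<phi> z - \<phi>\<^sup>*\<close>; after \<open>\<tau>\<close> the drop is at least logarithmic in \<open>t\<close>, which bounds the restarting time
  from above. So each restart contracts the gap by a fixed factor within a bounded time.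
\<close>

section \<open>Gradient and Hessian of a smooth convex function\<close>

lemma GDERIV_grad:
  fixes \<phi> :: "real ^ 'n \<Rightarrow> real"
  assumes "\<phi> differentiable at x"
  shows "GDERIV \<phi> x :> grad \<phi> x"
proof -
  obtain \<phi>' where der: "(\<phi> has_derivative \<phi>') (at x)"
    using assms by (auto simp: differentiable_def)
  \<comment> \<open>Riesz representation: the adjoint of a linear functional sends 1 to its
    representing vector. This supplies existence for the \<open>THE\<close> in \<open>grad\<close>;
    the next block supplies uniqueness.\<close>
  have "\<phi>' = (\<lambda>h. h \<bullet> adjoint \<phi>' 1)"
    using adjoint_works[OF has_derivative_linear[OF der]] by (auto simp: fun_eq_iff)
  then have ex: "GDERIV \<phi> x :> adjoint \<phi>' 1"
    using der by (simp add: gderiv_def)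
  have "D = adjoint \<phi>' 1" if "GDERIV \<phi> x :> D" for D
  proof -
    have "(\<lambda>h. h \<bullet> D) = (\<lambda>h. h \<bullet> adjoint \<phi>' 1)"
      using that ex unfolding gderiv_def by (rule has_derivative_unique)
    then show ?thesis
      by (metis vector_eq_ldot)
  qed
  with ex show ?thesis
    unfolding grad_def by (rule theI)
qed

lemma has_derivative_grad:
  assumes "grad \<phi> differentiable at x"
  shows "(grad \<phi> has_derivative (\<lambda>h. hess \<phi> x *v h)) (at x)"
  using assms unfolding hess_def by (simp add: jacobian_works)

lemma DERIV_along_line:
  fixes \<phi> :: "real ^ 'n \<Rightarrow> real"
  assumes "\<phi> differentiable at (x + h *\<^sub>R v)"
  shows "((\<lambda>h. \<phi> (x + h *\<^sub>R v)) has_real_derivative grad \<phi> (x + h *\<^sub>R v) \<bullet> v) (at h)"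
proof -
  have "((\<lambda>h. x + h *\<^sub>R v) has_derivative (\<lambda>h. h *\<^sub>R v)) (at h)"
    by (auto intro!: derivative_eq_intros)
  from has_derivative_compose[OF this GDERIV_grad[OF assms, unfolded gderiv_def]]
  show ?thesis
    by (simp add: has_field_derivative_def inner_commute mult_commute_abs)
qed

text \<open>Restricting to the line from \<open>x\<close> to \<open>y\<close> reduces this to the
  tangent inequality for a convex function of one variable.\<close>

lemma convex_gradient_inequality:
  fixes \<phi> :: "real ^ 'n \<Rightarrow> real"
  assumes "convex_on UNIV \<phi>" and "\<phi> differentiable at x"
  shows "\<phi> y \<ge> \<phi> x + grad \<phi> x \<bullet> (y - x)"
proof -
  let ?f = "\<lambda>h. \<phi> (x + h *\<^sub>R (y - x))"
  have "convex_on UNIV ?f"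
  proof (intro convex_onI)
    fix t a b :: real
    assume "0 < t" "t < 1"
    have "x + ((1 - t) *\<^sub>R a + t *\<^sub>R b) *\<^sub>R (y - x)
        = (1 - t) *\<^sub>R (x + a *\<^sub>R (y - x)) + t *\<^sub>R (x + b *\<^sub>R (y - x))"
      by (simp add: algebra_simps)
    with convex_onD[OF assms(1), of t "x + a *\<^sub>R (y - x)" "x + b *\<^sub>R (y - x)"] \<open>0 < t\<close> \<open>t < 1\<close>
    show "?f ((1 - t) *\<^sub>R a + t *\<^sub>R b) \<le> (1 - t) * ?f a + t * ?f b"
      by simp
  qed auto
  moreover have "(?f has_real_derivative grad \<phi> x \<bullet> (y - x)) (at 0)"
    using DERIV_along_line[of \<phi> x 0 "y - x"] assms(2) by simp
  ultimately have "?f 1 - ?f 0 \<ge> (grad \<phi> x \<bullet> (y - x)) * (1 - 0)"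
    by (intro convex_on_imp_above_tangent) auto
  then show ?thesis by simp
qed

text \<open>Sum of the tangent inequalities at \<open>x\<close> and at \<open>y\<close>.\<close>

lemma grad_monotone:
  fixes \<phi> :: "real ^ 'n \<Rightarrow> real"
  assumes "convex_on UNIV \<phi>" and "\<phi> differentiable at x" and "\<phi> differentiable at y"
  shows "0 \<le> (grad \<phi> y - grad \<phi> x) \<bullet> (y - x)"
  using convex_gradient_inequality[OF assms(1,2), of y]
    convex_gradient_inequality[OF assms(1,3), of x]
  by (simp add: inner_diff)

lemma DERIV_grad_along_line:
  fixes \<phi> :: "real ^ 'n \<Rightarrow> real"
  assumes "grad \<phi> differentiable at x"
  shows "((\<lambda>h. grad \<phi> (x + h *\<^sub>R v) \<bullet> w) has_real_derivative (hess \<phi> x *v v) \<bullet> w) (at 0)"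
proof -
  have line: "((\<lambda>h. x + h *\<^sub>R v) has_derivative (\<lambda>h. h *\<^sub>R v)) (at 0)"
    by (auto intro!: derivative_eq_intros)
  have "((\<lambda>h. grad \<phi> (x + h *\<^sub>R v)) has_derivative (\<lambda>h. hess \<phi> x *v (h *\<^sub>R v))) (at 0)"
    using has_derivative_compose[OF line, of "grad \<phi>"] has_derivative_grad[OF assms] by simp
  from has_derivative_inner_left[OF this, of w] show ?thesis
    by (simp add: has_field_derivative_def matrix_vector_mult_scaleR mult_commute_abs)
qed

text \<open>The quadratic form is the limit of difference quotients of the gradient, and these are
  nonnegative for either sign of \<open>h\<close> by monotonicity.\<close>

lemma hess_nonneg:
  fixes \<phi> :: "real ^ 'n \<Rightarrow> real"
  assumes "convex_on UNIV \<phi>" and "\<And>x. \<phi> differentiable at x" and "grad \<phi> differentiable at x"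
  shows "0 \<le> (hess \<phi> x *v v) \<bullet> v"
proof (rule tendsto_lowerbound)
  show "((\<lambda>h. (grad \<phi> (x + h *\<^sub>R v) \<bullet> v - grad \<phi> x \<bullet> v) / h) \<longlongrightarrow> (hess \<phi> x *v v) \<bullet> v) (at 0)"
    using DERIV_grad_along_line[OF assms(3), of v v] by (simp add: DERIV_def)
  have "0 \<le> (grad \<phi> (x + h *\<^sub>R v) \<bullet> v - grad \<phi> x \<bullet> v) / h" for h
  proof (cases "h = 0")
    case False
    have "0 \<le> (grad \<phi> (x + h *\<^sub>R v) - grad \<phi> x) \<bullet> (h *\<^sub>R v)"
      using grad_monotone[OF assms(1,2,2), of "x + h *\<^sub>R v" x] by simp
    with False show ?thesis
      by (auto simp: inner_diff_left zero_le_divide_iff zero_le_mult_iff)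
  qed simp
  then show "\<forall>\<^sub>F h in at 0. 0 \<le> (grad \<phi> (x + h *\<^sub>R v) \<bullet> v - grad \<phi> x \<bullet> v) / h"
    by simp
qed simp

text \<open>The Lipschitz bound on difference quotients is tested against the vector
  \<open>?w\<close> itself. In the limit |w|^2 \<le> L |v| |w|, and one factor |w| cancels.\<close>

lemma norm_hess_le:
  fixes \<phi> :: "real ^ 'n \<Rightarrow> real"
  assumes "L-lipschitz_on UNIV (grad \<phi>)" and "grad \<phi> differentiable at x"
  shows "norm (hess \<phi> x *v v) \<le> L * norm v"
proof -
  let ?w = "hess \<phi> x *v v"
  let ?q = "\<lambda>h. (grad \<phi> (x + h *\<^sub>R v) \<bullet> ?w - grad \<phi> x \<bullet> ?w) / h"
  have "?q h \<le> L * norm v * norm ?w" if "h \<noteq> 0" for h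
  proof -
    have "\<bar>?q h\<bar> \<le> norm (grad \<phi> (x + h *\<^sub>R v) - grad \<phi> x) * norm ?w / \<bar>h\<bar>"
      using Cauchy_Schwarz_ineq2[of "grad \<phi> (x + h *\<^sub>R v) - grad \<phi> x" ?w]
      by (simp add: inner_diff_left divide_right_mono)
    also have "\<dots> \<le> (L * norm (h *\<^sub>R v)) * norm ?w / \<bar>h\<bar>"
      using lipschitz_onD[OF assms(1), of "x + h *\<^sub>R v" x]
      by (intro divide_right_mono mult_right_mono) (auto simp: dist_norm)
    also have "\<dots> = L * norm v * norm ?w"
      using that by simp
    finally show ?thesis by (rule abs_le_D1)
  qed
  then have ev: "\<forall>\<^sub>F h in at 0. ?q h \<le> L * norm v * norm ?w"
    by (simp add: eventually_at_filter)
  have "(?q \<longlongrightarrow> ?w \<bullet> ?w) (at 0)"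
    using DERIV_grad_along_line[OF assms(2), of v ?w] by (simp add: DERIV_def)
  from tendsto_upperbound[OF this ev] have "norm ?w * norm ?w \<le> L * norm v * norm ?w"
    by (simp add: power2_norm_eq_inner flip: power2_eq_square)
  then show ?thesis
    using lipschitz_on_nonneg[OF assms(1)] by (cases "?w = 0") (auto simp: mult_le_cancel_right)
qed

text \<open>Along the segment, \<phi> minus its quadratic upper model is nonincreasing, because the
  Lipschitz bound on the gradient dominates its derivative.\<close>

lemma descent_lemma:
  fixes \<phi> :: "real ^ 'n \<Rightarrow> real"
  assumes "\<And>x. \<phi> differentiable at x" and "L-lipschitz_on UNIV (grad \<phi>)"
  shows "\<phi> y \<le> \<phi> x + grad \<phi> x \<bullet> (y - x) + L / 2 * (norm (y - x))\<^sup>2"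
proof -
  let ?v = "y - x"
  let ?f = "\<lambda>h. \<phi> (x + h *\<^sub>R ?v) - h * (grad \<phi> x \<bullet> ?v) - L / 2 * (norm ?v)\<^sup>2 * h\<^sup>2"
  have der: "(?f has_real_derivative (grad \<phi> (x + h *\<^sub>R ?v) - grad \<phi> x) \<bullet> ?v - L * h * (norm ?v)\<^sup>2) (at h)"
    for h
    using DERIV_along_line[where \<phi> = \<phi> and x = x and h = h and v = ?v] assms(1)
    by (auto intro!: derivative_eq_intros simp: inner_diff_left)
  have "?f 1 \<le> ?f 0"
  proof (rule DERIV_nonpos_imp_nonincreasing[where f = ?f])
    fix h :: real
    assume "0 \<le> h" "h \<le> 1"
    have "(grad \<phi> (x + h *\<^sub>R ?v) - grad \<phi> x) \<bullet> ?v \<le> norm (grad \<phi> (x + h *\<^sub>R ?v) - grad \<phi> x) * norm ?v"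
      by (rule norm_cauchy_schwarz)
    also have "\<dots> \<le> L * norm (h *\<^sub>R ?v) * norm ?v"
      using lipschitz_onD[OF assms(2), of "x + h *\<^sub>R ?v" x]
      by (intro mult_right_mono) (auto simp: dist_norm)
    also have "\<dots> = L * h * (norm ?v)\<^sup>2"
      using \<open>0 \<le> h\<close> by (simp add: power2_eq_square)
    finally show "\<exists>d. (?f has_real_derivative d) (at h) \<and> d \<le> 0"
      using der by force
  qed simp
  then show ?thesis by simp
qed


section \<open>Regularity of a single trajectory\<close>

locale hessian_damped_solution =
  fixes \<phi> :: "real ^ 'n \<Rightarrow> real" and \<alpha> \<beta> L :: real
    and z :: "real ^ 'n" and x :: "real \<Rightarrow> real ^ 'n"
  assumes convex: "convex_on UNIV \<phi>"
    and smooth: "twice_continuously_differentiable \<phi>"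
    and L_pos: "L > 0" and lipschitz: "L-lipschitz_on UNIV (grad \<phi>)"
    and alpha_pos: "\<alpha> > 0" and beta_pos: "\<beta> > 0"
    and solution: "is_solution \<phi> \<alpha> \<beta> z x"
begin

abbreviation "v \<equiv> velocity x"
abbreviation "a \<equiv> acceleration x"
abbreviation "G \<equiv> norm (grad \<phi> z)"

lemma phi_differentiable: "\<phi> differentiable at u"
  and grad_differentiable: "grad \<phi> differentiable at u"
  using smooth
  by (auto simp: twice_continuously_differentiable_def differentiable_on_def)

lemma x_0: "x 0 = z" and v_0: "v 0 = 0"
  and equation: "t > 0 \<Longrightarrow> a t + (\<alpha> / t) *\<^sub>R v t + grad \<phi> (x t) + \<beta> *\<^sub>R (hess \<phi> (x t) *v v t) = 0"
  using solution by (auto simp: is_solution_def)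

lemma continuous_on_x: "continuous_on {0..} x"
  and continuous_on_v: "continuous_on {0..} v"
  using solution differentiable_imp_continuous_on by (auto simp: is_solution_def)

lemma has_vector_derivative_x:
  assumes "t > 0"
  shows "(x has_vector_derivative v t) (at t)"
proof -
  have "x differentiable (at t within {0..})"
    using solution assms by (auto simp: is_solution_def differentiable_on_def)
  moreover have "at t within {0..} = at t"
    using assms by (intro at_within_interior) simp
  ultimately show ?thesis
    unfolding velocity_def by (metis vector_derivative_works)
qed

lemma has_vector_derivative_v:
  assumes "t > 0"
  shows "(v has_vector_derivative a t) (at t)"
proof -
  have "v differentiable (at t)"
    using solution assms by (simp add: is_solution_def C1_differentiable_on_eq)
  then show ?thesis
    unfolding acceleration_def by (simp only: vector_derivative_works)
qed

lemma DERIV_speed: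
  assumes "t > 0"
  shows "((\<lambda>s. (norm (v s))\<^sup>2) has_real_derivative 2 * (v t \<bullet> a t)) (at t)"
proof -
  have "((\<lambda>s. v s \<bullet> v s) has_derivative (\<lambda>h. v t \<bullet> (h *\<^sub>R a t) + (h *\<^sub>R a t) \<bullet> v t)) (at t)"
    using has_vector_derivative_v[OF assms] unfolding has_vector_derivative_def
    by (intro has_derivative_inner)
  moreover have "(\<lambda>h. v t \<bullet> (h *\<^sub>R a t) + (h *\<^sub>R a t) \<bullet> v t) = (*) (2 * (v t \<bullet> a t))"
    by (simp add: fun_eq_iff inner_commute)
  ultimately show ?thesis
    by (simp add: has_field_derivative_def power2_norm_eq_inner)
qed

lemma DERIV_phi:
  assumes "t > 0"
  shows "((\<lambda>s. \<phi> (x s)) has_real_derivative grad \<phi> (x t) \<bullet> v t) (at t)"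
  using has_derivative_compose[OF has_vector_derivative_x[OF assms, unfolded has_vector_derivative_def]
      GDERIV_grad[OF phi_differentiable, unfolded gderiv_def]]
  by (simp add: has_field_derivative_def inner_commute mult_commute_abs)

section \<open>Estimates on the initial time window\<close>

lemma displacement_le:
  assumes "0 \<le> s" and "\<And>u. 0 \<le> u \<Longrightarrow> u \<le> s \<Longrightarrow> norm (v u) \<le> V"
  shows "norm (x s - z) \<le> s * V"
proof (cases "s = 0")
  case False
  have "norm (x s - x 0) \<le> V * s - V * 0"
  \<comment> \<open>This mean value inequality asks for derivatives only at interior times and for
    continuity at the ends, so the singular time 0 is harmless.\<close>
  proof (rule differentiable_bound_general)
    show "continuous_on {0..s} x"
      by (rule continuous_on_subset[OF continuous_on_x]) auto
    show "((*) V has_vector_derivative V) (at u)" for u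
      unfolding has_real_derivative_iff_has_vector_derivative[symmetric]
      by (auto intro!: derivative_eq_intros)
    show "continuous_on {0..s} ((*) V)"
      by (intro continuous_intros)
    show "norm (v u) \<le> V" if "0 < u" "u < s" for u
      using that assms(2) by simp
  qed (use False assms(1) has_vector_derivative_x in simp_all)
  then show ?thesis by (simp add: x_0 mult.commute)
qed (simp add: x_0)

text \<open>The equation says that \<open>(t\<^sup>\<alpha> x')' = - t\<^sup>\<alpha> (\<nabla>\<phi>(x) + \<beta> \<nabla>\<^sup>2\<phi>(x) x')\<close>, where the right-hand side
  differs from \<open>- t\<^sup>\<alpha> \<nabla>\<phi>(z)\<close> by at most \<open>t\<^sup>\<alpha> L (t + \<beta>) V\<close>.\<close>

lemma force_error:
  assumes "0 < s" and "\<And>u. 0 \<le> u \<Longrightarrow> u \<le> s \<Longrightarrow> norm (v u) \<le> V"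
  shows "norm (grad \<phi> (x s) + \<beta> *\<^sub>R (hess \<phi> (x s) *v v s) - grad \<phi> z) \<le> L * (s + \<beta>) * V"
proof -
  have "norm (grad \<phi> (x s) - grad \<phi> z) \<le> L * norm (x s - z)"
    using lipschitz_onD[OF lipschitz, of "x s" z] by (simp add: dist_norm)
  also have "\<dots> \<le> L * (s * V)"
    using displacement_le[of s V] assms L_pos by (intro mult_left_mono) auto
  finally have 1: "norm (grad \<phi> (x s) - grad \<phi> z) \<le> L * (s * V)" .
  have "norm (\<beta> *\<^sub>R (hess \<phi> (x s) *v v s)) \<le> \<beta> * (L * norm (v s))"
    using norm_hess_le[OF lipschitz grad_differentiable, of "x s" "v s"] beta_pos by simp
  also have "\<dots> \<le> \<beta> * (L * V)"
    using assms L_pos beta_pos by (intro mult_left_mono) auto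
  finally have 2: "norm (\<beta> *\<^sub>R (hess \<phi> (x s) *v v s)) \<le> \<beta> * (L * V)" .
  have "norm (grad \<phi> (x s) + \<beta> *\<^sub>R (hess \<phi> (x s) *v v s) - grad \<phi> z)
      = norm ((grad \<phi> (x s) - grad \<phi> z) + \<beta> *\<^sub>R (hess \<phi> (x s) *v v s))"
    by (simp add: algebra_simps)
  also have "\<dots> \<le> L * (s * V) + \<beta> * (L * V)"
    using 1 2 by (rule norm_triangle_mono)
  finally show ?thesis by (simp add: algebra_simps)
qed

lemma velocity_expansion:
  assumes "0 \<le> s" and bound: "\<And>u. 0 \<le> u \<Longrightarrow> u \<le> s \<Longrightarrow> norm (v u) \<le> V"
  shows "norm (v s + (s / (\<alpha> + 1)) *\<^sub>R grad \<phi> z) \<le> s / (\<alpha> + 1) * (L * (s + \<beta>) * V)"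
proof (cases "s = 0")
  case True
  then show ?thesis by (simp add: v_0)
next
  case False
  with assms have s: "0 < s" by simp
  define B where "B = L * (s + \<beta>) * V"
  have V: "0 \<le> V"
    using bound[of 0] assms(1) by (simp add: v_0)
  let ?P = "\<lambda>u. u powr (\<alpha> + 1) / (\<alpha> + 1)"
  \<comment> \<open>With the integrating factor u^\<alpha>, the equation reads \<open>?w\<close>' =
    - u^\<alpha> \<open>?r\<close>. Since \<open>?w\<close> vanishes at 0, a bound \<open>B\<close>
    on \<open>?r\<close> gives |w(s)| \<le> P(s) B; dividing by s^\<alpha> finishes.\<close>
  let ?w = "\<lambda>u. u powr \<alpha> *\<^sub>R v u + ?P u *\<^sub>R grad \<phi> z"
  let ?r = "\<lambda>u. grad \<phi> (x u) + \<beta> *\<^sub>R (hess \<phi> (x u) *v v u) - grad \<phi> z"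
  have powr_cont: "continuous_on {0..s} (\<lambda>u. u powr p)" if "p > 0" for p :: real
    using that by (intro continuous_on_powr') (auto intro: continuous_intros)
  have P: "(?P has_real_derivative u powr \<alpha>) (at u)" if "0 < u" for u
    using that alpha_pos by (auto intro!: derivative_eq_intros)
  have "norm (?w s - ?w 0) \<le> ?P s * B - ?P 0 * B"
  proof (rule differentiable_bound_general[OF s])
    show "continuous_on {0..s} ?w"
      using alpha_pos by (intro continuous_intros powr_cont
          continuous_on_subset[OF continuous_on_v]) auto
    show "continuous_on {0..s} (\<lambda>u. ?P u * B)"
      using alpha_pos by (intro continuous_intros powr_cont) auto
    fix u
    assume u: "0 < u" "u < s"
    show "((\<lambda>u. ?P u * B) has_vector_derivative u powr \<alpha> * B) (at u)"
      unfolding has_real_derivative_iff_has_vector_derivative[symmetric]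
      by (rule DERIV_cmult_right[OF P[OF u(1)]])
    have "((\<lambda>u. u powr \<alpha>) has_real_derivative \<alpha> * u powr (\<alpha> - 1)) (at u)"
      using has_real_derivative_powr[OF u(1), of \<alpha>] by simp
    from has_vector_derivative_add[OF
        has_vector_derivative_scaleR[OF this has_vector_derivative_v[OF u(1)]]
        has_vector_derivative_scaleR[OF P[OF u(1)] has_vector_derivative_const]]
    have "(?w has_vector_derivative
        (u powr \<alpha> *\<^sub>R a u + (\<alpha> * u powr (\<alpha> - 1)) *\<^sub>R v u) + u powr \<alpha> *\<^sub>R grad \<phi> z) (at u)"
      by simp
    moreover have "(u powr \<alpha> *\<^sub>R a u + (\<alpha> * u powr (\<alpha> - 1)) *\<^sub>R v u) + u powr \<alpha> *\<^sub>R grad \<phi> z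
        = u powr \<alpha> *\<^sub>R (a u + (\<alpha> / u) *\<^sub>R v u + grad \<phi> z)"
      using u(1) by (simp add: powr_diff algebra_simps)
    moreover have "a u + (\<alpha> / u) *\<^sub>R v u + grad \<phi> z = - ?r u"
      using equation[OF u(1)] by (simp add: algebra_simps add_eq_0_iff)
    ultimately show "(?w has_vector_derivative u powr \<alpha> *\<^sub>R - ?r u) (at u)"
      by simp
    have "norm (?r u) \<le> L * (u + \<beta>) * V"
      using u bound by (intro force_error) auto
    also have "\<dots> \<le> B"
      unfolding B_def using u L_pos V by (intro mult_right_mono mult_left_mono) auto
    finally show "norm (u powr \<alpha> *\<^sub>R - ?r u) \<le> u powr \<alpha> * B"
      by (simp only: norm_scaleR norm_minus_cancel) (simp add: mult_left_mono)
  qed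
  then have "norm (?w s) \<le> ?P s * B"
    using alpha_pos by (simp add: v_0)
  moreover have "?w s = s powr \<alpha> *\<^sub>R (v s + (s / (\<alpha> + 1)) *\<^sub>R grad \<phi> z)"
    using s by (simp add: powr_add algebra_simps)
  ultimately have "s powr \<alpha> * norm (v s + (s / (\<alpha> + 1)) *\<^sub>R grad \<phi> z) \<le> s powr \<alpha> * (s / (\<alpha> + 1) * B)"
    using s by (simp add: powr_add)
  then have "norm (v s + (s / (\<alpha> + 1)) *\<^sub>R grad \<phi> z) \<le> s / (\<alpha> + 1) * B"
    by (rule mult_left_le_imp_le) (use s in simp)
  then show ?thesis
    by (simp only: B_def)
qed

text \<open>A bootstrap: at a maximizer \<open>s\<close> of the speed on [0, t],
  \<open>velocity_expansion\<close> bounds the maximum by t G / (\<alpha> + 1) plus a small multiple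
  of the maximum itself, which is absorbed on the left.\<close>

lemma speed_le:
  assumes "0 \<le> t" and small: "16 * L * t * (t + \<beta>) \<le> 1"
  shows "norm (v t) \<le> 2 * t * G / (\<alpha> + 1)"
proof -
  obtain s where s: "s \<in> {0..t}" and max: "\<And>u. u \<in> {0..t} \<Longrightarrow> norm (v u) \<le> norm (v s)"
  proof -
    have "continuous_on {0..t} (\<lambda>u. norm (v u))"
      by (intro continuous_on_norm continuous_on_subset[OF continuous_on_v]) auto
    then show ?thesis
      using continuous_attains_sup[of "{0..t}" "\<lambda>u. norm (v u)"] assms(1) that by auto
  qed
  let ?V = "norm (v s)"
  have "norm (v s + (s / (\<alpha> + 1)) *\<^sub>R grad \<phi> z) \<le> s / (\<alpha> + 1) * (L * (s + \<beta>) * ?V)"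
    using s max by (intro velocity_expansion) auto
  moreover have "?V \<le> norm (v s + (s / (\<alpha> + 1)) *\<^sub>R grad \<phi> z) + norm ((s / (\<alpha> + 1)) *\<^sub>R grad \<phi> z)"
    by (metis add_diff_cancel norm_triangle_ineq4)
  moreover have "norm ((s / (\<alpha> + 1)) *\<^sub>R grad \<phi> z) = s * G / (\<alpha> + 1)"
    using s alpha_pos by simp
  moreover have "s * G / (\<alpha> + 1) \<le> t * G / (\<alpha> + 1)"
    using s alpha_pos by (intro divide_right_mono mult_right_mono) auto
  \<comment> \<open>For the absorption 1/2 is enough. The constant 16 in the window condition gives
    more, and the later error estimates use it.\<close>
  moreover have "s / (\<alpha> + 1) * (L * (s + \<beta>) * ?V) \<le> 1 / 2 * ?V"
  proof -
    have "s / (\<alpha> + 1) * (L * (s + \<beta>)) \<le> s * (L * (s + \<beta>))"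
      using s L_pos beta_pos alpha_pos
      by (intro mult_right_mono) (auto simp: divide_le_eq algebra_simps)
    also have "\<dots> \<le> t * (L * (t + \<beta>))"
      using s L_pos beta_pos by (intro mult_mono) auto
    also have "\<dots> \<le> 1 / 2"
      using small by (simp add: algebra_simps)
    finally have "s / (\<alpha> + 1) * (L * (s + \<beta>)) * ?V \<le> 1 / 2 * ?V"
      by (rule mult_right_mono) simp
    then show ?thesis by (simp only: mult.assoc)
  qed
  ultimately have "?V \<le> 2 * (t * G / (\<alpha> + 1))"
    by linarith
  then show ?thesis
    using max[of t] assms(1) by simp
qed


text \<open>This is the bound of \<open>force_error\<close> with the speed bound from
  \<open>speed_le\<close> inserted for \<open>V\<close>; the factor 1/8 is 2/16.\<close>

lemma error_le:
  assumes "16 * L * t * (t + \<beta>) \<le> 1"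
  shows "L * (t + \<beta>) * (2 * t * G / (\<alpha> + 1)) \<le> G / (8 * (\<alpha> + 1))"
proof -
  have "(L * (t + \<beta>) * 2 * t) * (G / (\<alpha> + 1)) \<le> 1 / 8 * (G / (\<alpha> + 1))"
    using assms alpha_pos by (intro mult_right_mono) (auto simp: algebra_simps)
  moreover have "L * (t + \<beta>) * (2 * t * G / (\<alpha> + 1)) = (L * (t + \<beta>) * 2 * t) * (G / (\<alpha> + 1))"
    by simp
  ultimately show ?thesis by simp
qed

lemma speed_le_of_le:
  assumes "16 * L * t * (t + \<beta>) \<le> 1" and "0 \<le> u" and "u \<le> t"
  shows "norm (v u) \<le> 2 * t * G / (\<alpha> + 1)"
proof -
  have "16 * L * u * (u + \<beta>) \<le> 16 * L * t * (t + \<beta>)"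
    using assms L_pos beta_pos by (intro mult_mono) auto
  then have "norm (v u) \<le> 2 * u * G / (\<alpha> + 1)"
    using assms by (intro speed_le) auto
  also have "\<dots> \<le> 2 * t * G / (\<alpha> + 1)"
    using assms alpha_pos by (intro divide_right_mono mult_right_mono) auto
  finally show ?thesis .
qed

text \<open>The speed bound is fed back into \<open>velocity_expansion\<close>, so that the error is
  now measured by \<open>G\<close> alone.\<close>

lemma velocity_near_start:
  assumes "0 \<le> t" and small: "16 * L * t * (t + \<beta>) \<le> 1"
  shows "norm (v t + (t / (\<alpha> + 1)) *\<^sub>R grad \<phi> z) \<le> t / (\<alpha> + 1) * (G / (8 * (\<alpha> + 1)))"
proof -
  have "norm (v t + (t / (\<alpha> + 1)) *\<^sub>R grad \<phi> z)
      \<le> t / (\<alpha> + 1) * (L * (t + \<beta>) * (2 * t * G / (\<alpha> + 1)))"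
    using assms speed_le_of_le by (intro velocity_expansion)
  also have "\<dots> \<le> t / (\<alpha> + 1) * (G / (8 * (\<alpha> + 1)))"
    using error_le[OF small] assms(1) alpha_pos by (intro mult_left_mono) auto
  finally show ?thesis .
qed

text \<open>Reverse triangle inequality: the error in \<open>velocity_near_start\<close> is at most
  half of the main term t G / (\<alpha> + 1).\<close>

lemma speed_ge:
  assumes "0 \<le> t" and "16 * L * t * (t + \<beta>) \<le> 1"
  shows "t * (G / (2 * (\<alpha> + 1))) \<le> norm (v t)"
proof -
  have "t / (\<alpha> + 1) * (G / (8 * (\<alpha> + 1))) \<le> t / (\<alpha> + 1) * (G / 2)"
    using alpha_pos assms(1) by (intro mult_left_mono divide_left_mono) auto
  moreover have "norm ((t / (\<alpha> + 1)) *\<^sub>R grad \<phi> z) = t / (\<alpha> + 1) * G"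
    using assms(1) alpha_pos by simp
  moreover have "norm ((t / (\<alpha> + 1)) *\<^sub>R grad \<phi> z)
      \<le> norm (v t + (t / (\<alpha> + 1)) *\<^sub>R grad \<phi> z) + norm (v t)"
    by (metis add_diff_cancel_left' norm_triangle_ineq4)
  ultimately have "t / (\<alpha> + 1) * G - t / (\<alpha> + 1) * (G / 2) \<le> norm (v t)"
    using velocity_near_start[OF assms] by linarith
  moreover have "t / (\<alpha> + 1) * G - t / (\<alpha> + 1) * (G / 2) = t * (G / (2 * (\<alpha> + 1)))"
  proof -
    have "t / c * G - t / c * (G / 2) = t * (G / (2 * c))" for c
      by (cases "c = 0") (auto simp: field_simps)
    then show ?thesis .
  qed
  ultimately show ?thesis by simp
qed

text \<open>For small \<open>t\<close>, \<open>x'(t)\<close> and \<open>x''(t)\<close> are close to \<open>- t / (\<alpha> + 1) \<nabla>\<phi>(z)\<close> and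
  \<open>- 1 / (\<alpha> + 1) \<nabla>\<phi>(z)\<close>, hence nearly parallel.\<close>

lemma speed_increasing_near_start:
  assumes "0 < t" and small: "16 * L * t * (t + \<beta>) \<le> 1" and "0 < G"
  shows "0 < v t \<bullet> a t"
proof -
  define c where "c = \<alpha> + 1"
  have c: "1 < c" using alpha_pos by (simp add: c_def)
  let ?g = "grad \<phi> z"
  \<comment> \<open>The errors of the two approximations: v = - ((t/c) g - w) and a = - (g/c + q),
    where \<open>r\<close> is the error in the force.\<close>
  define w where "w = v t + (t / c) *\<^sub>R ?g"
  define r where "r = grad \<phi> (x t) + \<beta> *\<^sub>R (hess \<phi> (x t) *v v t) - ?g"
  define q where "q = (\<alpha> / t) *\<^sub>R w + r"
  have w: "norm w \<le> t / c * (G / (8 * c))"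
    using velocity_near_start[of t] assms by (simp add: w_def c_def)
  have "norm r \<le> L * (t + \<beta>) * (2 * t * G / (\<alpha> + 1))"
    unfolding r_def using assms(1) speed_le_of_le[OF small] by (intro force_error)
  with error_le[OF small] have r: "norm r \<le> G / (8 * c)"
    by (simp add: c_def)
  have "norm q \<le> \<alpha> / t * norm w + norm r"
    unfolding q_def using norm_triangle_ineq[of "(\<alpha> / t) *\<^sub>R w" r] assms(1) alpha_pos by simp
  also have "\<dots> \<le> \<alpha> / t * (t / c * (G / (8 * c))) + G / (8 * c)"
    using w r assms(1) alpha_pos by (intro add_mono mult_left_mono) auto
  also have "\<dots> = \<alpha> / c * (G / (8 * c)) + G / (8 * c)"
    using assms(1) by simp
  also have "\<dots> \<le> 1 * (G / (8 * c)) + G / (8 * c)"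
    using c by (intro add_mono mult_right_mono) (auto simp: c_def)
  finally have q: "norm q \<le> G / (4 * c)" by (simp add: field_simps)
  have w': "norm w \<le> t * G / (8 * c)"
  proof -
    have "t / c * (G / (8 * c)) \<le> t * (G / (8 * c))"
      using c assms(1) by (intro mult_right_mono) (auto simp: divide_le_eq mult_le_cancel_left)
    with w show ?thesis by simp
  qed
  have "v t = - ((t / c) *\<^sub>R ?g - w)"
    by (simp add: w_def)
  moreover have "a t = - ((1 / c) *\<^sub>R ?g + q)"
  proof -
    have "(\<alpha> / t) *\<^sub>R w = (\<alpha> / t) *\<^sub>R v t + (\<alpha> / c) *\<^sub>R ?g"
      using assms(1) by (simp add: w_def algebra_simps)
    moreover have "(1 / c) *\<^sub>R ?g + (\<alpha> / c) *\<^sub>R ?g = ?g"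
    proof -
      have "1 / c + \<alpha> / c = 1"
        using c by (simp add: c_def field_simps)
      then show ?thesis by (metis scaleR_add_left scaleR_one)
    qed
    ultimately have "(1 / c) *\<^sub>R ?g + q = (\<alpha> / t) *\<^sub>R v t + ?g + r"
      by (simp add: q_def algebra_simps)
    then show ?thesis
      using equation[OF assms(1)] by (simp add: r_def algebra_simps add_eq_0_iff)
  qed
  ultimately have "v t \<bullet> a t = ((t / c) *\<^sub>R ?g - w) \<bullet> ((1 / c) *\<^sub>R ?g + q)"
    by (simp only: inner_minus_left inner_minus_right minus_minus)
  also have "\<dots> = t / c\<^sup>2 * G\<^sup>2 + t / c * (?g \<bullet> q) - 1 / c * (w \<bullet> ?g) - w \<bullet> q"
    by (simp add: inner_add_right inner_diff_left power2_norm_eq_inner power2_eq_square[of c]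
        diff_divide_distrib)
  also have "\<dots> \<ge> t / c\<^sup>2 * G\<^sup>2 - t / c * (G * (G / (4 * c))) - 1 / c * (t / c * (G / (8 * c)) * G)
      - t / c * (G / (8 * c)) * (G / (4 * c))"
  proof -
    have "\<bar>?g \<bullet> q\<bar> \<le> G * (G / (4 * c))"
      using Cauchy_Schwarz_ineq2[of ?g q] mult_left_mono[OF q, of G] by simp
    then have "t / c * (- (?g \<bullet> q)) \<le> t / c * (G * (G / (4 * c)))"
      using assms(1) c by (intro mult_left_mono) auto
    moreover have "1 / c * (w \<bullet> ?g) \<le> 1 / c * (t / c * (G / (8 * c)) * G)"
      using norm_cauchy_schwarz[of w ?g] mult_right_mono[OF w, of G] c
      by (intro mult_left_mono) auto
    moreover have "w \<bullet> q \<le> t / c * (G / (8 * c)) * (G / (4 * c))"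
      using norm_cauchy_schwarz[of w q] mult_mono[OF w q] assms(1) c by simp
    ultimately show ?thesis by linarith
  qed
  finally have "t / c\<^sup>2 * G\<^sup>2 - t / c * (G * (G / (4 * c))) - 1 / c * (t / c * (G / (8 * c)) * G)
      - t / c * (G / (8 * c)) * (G / (4 * c)) \<le> v t \<bullet> a t" .
  \<comment> \<open>Relative to the main term, the three errors are 1/4 from g and q, 1/(8c) from w
    and g, and 1/(32c) from w and q. Their sum stays below 1 since c > 1.\<close>
  moreover have "t / c\<^sup>2 * G\<^sup>2 - t / c * (G * (G / (4 * c))) - 1 / c * (t / c * (G / (8 * c)) * G)
      - t / c * (G / (8 * c)) * (G / (4 * c)) = t / c\<^sup>2 * G\<^sup>2 * (1 - 1 / 4 - 5 / (32 * c))"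
    using c by (simp add: field_simps power2_eq_square)
  moreover have "0 < t / c\<^sup>2 * G\<^sup>2 * (1 - 1 / 4 - 5 / (32 * c))"
    using c assms by (intro mult_pos_pos) (auto simp: field_simps)
  ultimately show ?thesis by linarith
qed

section \<open>Decrease of \<phi> while the speed increases\<close>

lemma power_le:
  assumes "0 < t" and "0 \<le> v t \<bullet> a t"
  shows "grad \<phi> (x t) \<bullet> v t \<le> - (\<alpha> / t * (norm (v t))\<^sup>2)"
proof -
  \<comment> \<open>Pairing the equation with the velocity leaves two terms of favourable sign: v a,
    by assumption, and the Hessian term, by convexity.\<close>
  have "(a t + (\<alpha> / t) *\<^sub>R v t + grad \<phi> (x t) + \<beta> *\<^sub>R (hess \<phi> (x t) *v v t)) \<bullet> v t = 0"
    using equation[OF assms(1)] by simp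
  then have "v t \<bullet> a t + \<alpha> / t * (norm (v t))\<^sup>2 + grad \<phi> (x t) \<bullet> v t
      + \<beta> * ((hess \<phi> (x t) *v v t) \<bullet> v t) = 0"
    by (simp add: inner_add_left power2_norm_eq_inner inner_commute[of "v t" "a t"])
  moreover have "0 \<le> \<beta> * ((hess \<phi> (x t) *v v t) \<bullet> v t)"
    using hess_nonneg[OF convex phi_differentiable grad_differentiable] beta_pos by simp
  ultimately show ?thesis using assms(2) by linarith
qed

lemma continuous_on_phi_x: "continuous_on {0..} (\<lambda>s. \<phi> (x s))"
proof -
  have "continuous_on UNIV \<phi>"
    by (simp add: continuous_at_imp_continuous_on differentiable_imp_continuous_within
        phi_differentiable)
  then show ?thesis
    by (rule continuous_on_compose2[OF _ continuous_on_x]) simp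
qed

text \<open>A comparison principle: any \<Psi> growing no faster than the dissipation \<alpha> |v|^2
  / u measures a guaranteed loss of \<phi>. It is applied with \<Psi> quadratic, logarithmic and
  zero. The hypotheses concern the open interval, so s = 0 is allowed.\<close>

lemma phi_drop:
  assumes "0 \<le> s" and "s \<le> t"
    and incr: "\<And>u. s < u \<Longrightarrow> u < t \<Longrightarrow> 0 \<le> v u \<bullet> a u"
    and cont: "continuous_on {s..t} \<Psi>"
    and der: "\<And>u. s < u \<Longrightarrow> u < t \<Longrightarrow> (\<Psi> has_real_derivative \<psi> u) (at u)"
    and le: "\<And>u. s < u \<Longrightarrow> u < t \<Longrightarrow> \<psi> u \<le> \<alpha> / u * (norm (v u))\<^sup>2"
  shows "\<phi> (x t) + \<Psi> t \<le> \<phi> (x s) + \<Psi> s"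
proof (rule DERIV_nonpos_imp_decreasing_open[where f = "\<lambda>u. \<phi> (x u) + \<Psi> u"])
  show "continuous_on {s..t} (\<lambda>u. \<phi> (x u) + \<Psi> u)"
    using assms(1) by (intro continuous_intros cont continuous_on_subset[OF continuous_on_phi_x]) auto
  fix u
  assume u: "s < u" "u < t"
  with assms(1) have "0 < u" by simp
  show "\<exists>d. ((\<lambda>u. \<phi> (x u) + \<Psi> u) has_real_derivative d) (at u) \<and> d \<le> 0"
    using DERIV_add[OF DERIV_phi[OF \<open>0 < u\<close>] der[OF u]] power_le[OF \<open>0 < u\<close> incr[OF u]] le[OF u]
    by force
qed fact

lemma phi_drop_near_start:
  assumes "0 \<le> t" and small: "16 * L * t * (t + \<beta>) \<le> 1" and "0 < G"
  shows "\<phi> (x t) + \<alpha> * (G / (2 * (\<alpha> + 1)))\<^sup>2 * t\<^sup>2 / 2 \<le> \<phi> z"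
proof -
  let ?k = "G / (2 * (\<alpha> + 1))"
  have smaller: "16 * L * u * (u + \<beta>) \<le> 1" if "0 < u" "u < t" for u
  proof -
    have "16 * L * u * (u + \<beta>) \<le> 16 * L * t * (t + \<beta>)"
      using that L_pos beta_pos by (intro mult_mono) auto
    with small show ?thesis by simp
  qed
  have "\<phi> (x t) + \<alpha> * ?k\<^sup>2 * t\<^sup>2 / 2 \<le> \<phi> (x 0) + \<alpha> * ?k\<^sup>2 * 0\<^sup>2 / 2"
  \<comment> \<open>By \<open>speed_ge\<close> the speed at time u is at least k u, so the
    dissipation is at least \<alpha> k^2 u, whose primitive is this \<Psi>.\<close>
  proof (rule phi_drop[where \<Psi> = "\<lambda>u. \<alpha> * ?k\<^sup>2 * u\<^sup>2 / 2" and \<psi> = "\<lambda>u. \<alpha> * ?k\<^sup>2 * u"])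
    fix u
    assume u: "0 < u" "u < t"
    show "0 \<le> v u \<bullet> a u"
      using speed_increasing_near_start[OF u(1) smaller[OF u] assms(3)] by simp
    show "((\<lambda>u. \<alpha> * ?k\<^sup>2 * u\<^sup>2 / 2) has_real_derivative \<alpha> * ?k\<^sup>2 * u) (at u)"
      by (rule derivative_eq_intros refl | simp)+
    have "(u * ?k)\<^sup>2 \<le> (norm (v u))\<^sup>2"
      using speed_ge[OF _ smaller[OF u]] u alpha_pos by (intro power_mono) auto
    then have "\<alpha> / u * (u * ?k)\<^sup>2 \<le> \<alpha> / u * (norm (v u))\<^sup>2"
      using u alpha_pos by (intro mult_left_mono) auto
    moreover have "\<alpha> / u * (u * ?k)\<^sup>2 = \<alpha> * ?k\<^sup>2 * u"
      using u(1) by (simp add: power_mult_distrib power2_eq_square)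
    ultimately show "\<alpha> * ?k\<^sup>2 * u \<le> \<alpha> / u * (norm (v u))\<^sup>2" by simp
  qed (use assms(1) in \<open>auto intro!: continuous_intros\<close>)
  then show ?thesis by (simp add: x_0)
qed

text \<open>After \<tau> the speed stays above its value at \<tau>, which is at least \<tau> G / (2
  (\<alpha> + 1)); the dissipation is then at least a constant over u, with a logarithm as
  primitive.\<close>

lemma phi_drop_log:
  assumes "0 < \<tau>" and small: "16 * L * \<tau> * (\<tau> + \<beta>) \<le> 1" and "\<tau> \<le> t"
    and incr: "\<And>u. 0 < u \<Longrightarrow> u < t \<Longrightarrow> 0 \<le> v u \<bullet> a u"
  shows "\<phi> (x t) + \<alpha> * (\<tau> * (G / (2 * (\<alpha> + 1))))\<^sup>2 * ln (t / \<tau>) \<le> \<phi> (x \<tau>)"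
proof -
  let ?k = "\<tau> * (G / (2 * (\<alpha> + 1)))"
  have "\<phi> (x t) + \<alpha> * ?k\<^sup>2 * ln (t / \<tau>) \<le> \<phi> (x \<tau>) + \<alpha> * ?k\<^sup>2 * ln (\<tau> / \<tau>)"
  proof (rule phi_drop[where \<Psi> = "\<lambda>u. \<alpha> * ?k\<^sup>2 * ln (u / \<tau>)" and \<psi> = "\<lambda>u. \<alpha> / u * ?k\<^sup>2"])
    show "continuous_on {\<tau>..t} (\<lambda>u. \<alpha> * ?k\<^sup>2 * ln (u / \<tau>))"
      using assms(1) by (auto intro!: continuous_intros)
    fix u
    assume u: "\<tau> < u" "u < t"
    then show "0 \<le> v u \<bullet> a u"
      using incr assms(1) by simp
    have "((\<lambda>u. ln (u / \<tau>)) has_real_derivative 1 / u) (at u)"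
      using assms(1) u by (auto intro!: derivative_eq_intros)
    from DERIV_cmult[OF this, of "\<alpha> * ?k\<^sup>2"]
    show "((\<lambda>u. \<alpha> * ?k\<^sup>2 * ln (u / \<tau>)) has_real_derivative \<alpha> / u * ?k\<^sup>2) (at u)"
      by (simp only: times_divide_eq_left times_divide_eq_right mult_1_left mult_1_right)
    have "?k\<^sup>2 \<le> (norm (v \<tau>))\<^sup>2"
      using speed_ge[OF _ small] assms(1) alpha_pos by (intro power_mono) auto
    also have "\<dots> \<le> (norm (v u))\<^sup>2"
    proof (rule DERIV_nonneg_imp_nondecreasing[where f = "\<lambda>s. (norm (v s))\<^sup>2"])
      fix s
      assume "\<tau> \<le> s" "s \<le> u"
      with assms(1) u have "0 < s" "0 \<le> v s \<bullet> a s"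
        using incr by auto
      then show "\<exists>d. ((\<lambda>s. (norm (v s))\<^sup>2) has_real_derivative d) (at s) \<and> 0 \<le> d"
        using DERIV_speed[of s] by force
    qed (use u in simp)
    finally show "\<alpha> / u * ?k\<^sup>2 \<le> \<alpha> / u * (norm (v u))\<^sup>2"
      using u assms(1) alpha_pos by (intro mult_left_mono) auto
  qed (use assms in auto)
  then show ?thesis using assms(1) by simp
qed


section \<open>Uniform bounds on the restarting time and the gap\<close>

lemma restart_time_eq: "restart_time x = Inf {t. 0 < t \<and> v t \<bullet> a t \<le> 0}"
proof -
  \<comment> \<open>At positive times \<open>deriv\<close> is a true derivative, and the factor 2
    does not affect its sign.\<close>
  have "deriv (\<lambda>s. (norm (v s))\<^sup>2) t = 2 * (v t \<bullet> a t)" if "0 < t" for t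
    using DERIV_speed[OF that] by (rule DERIV_imp_deriv)
  then show ?thesis
    unfolding restart_time_def by (auto intro!: arg_cong[where f = Inf])
qed

text \<open>Before the restart the speed stays above its value at \<open>\<tau>\<close>, so the decrease of \<open>\<phi>\<close>,
  which is at least logarithmic in time, exhausts \<open>\<phi> z - m\<close> after a bounded time.\<close>

lemma restart_time_bounds:
  fixes m \<mu> \<tau> :: real
  defines "R \<equiv> \<tau> * exp (2 * (\<alpha> + 1)\<^sup>2 / (\<mu> * \<alpha> * \<tau>\<^sup>2))"
  assumes "0 < \<tau>" and small: "16 * L * \<tau> * (\<tau> + \<beta>) \<le> 1" and "0 < G" and "0 < \<mu>"
    and PL: "\<mu> * (\<phi> z - m) \<le> 1 / 2 * G\<^sup>2" and lower: "\<And>u. m \<le> \<phi> u"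
  shows "\<tau> \<le> restart_time x" (is ?lb) and "restart_time x \<le> R" (is ?ub)
    and "\<And>t. 0 \<le> t \<Longrightarrow> t \<le> restart_time x \<Longrightarrow> \<phi> (x t) \<le> \<phi> z"
    and "\<phi> (x (restart_time x)) - m
      \<le> (1 - \<mu> * \<alpha> * \<tau>\<^sup>2 / (4 * (\<alpha> + 1)\<^sup>2)) * (\<phi> z - m)"
proof -
  let ?A = "{t. 0 < t \<and> v t \<bullet> a t \<le> 0}"
  let ?k = "G / (2 * (\<alpha> + 1))"
  have start: "\<phi> (x \<tau>) + \<alpha> * ?k\<^sup>2 * \<tau>\<^sup>2 / 2 \<le> \<phi> z"
    using phi_drop_near_start[OF _ small] assms by simp
  \<comment> \<open>The logarithmic loss cannot exceed the gap, which is at most G^2 / (2 \<mu>).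
    Solving for \<open>t\<close>, the factor G^2 cancels, so \<open>R\<close> does not depend on
    \<open>z\<close>.\<close>
  have le_R: "t \<le> R" if "\<tau> \<le> t" and incr: "\<And>u. 0 < u \<Longrightarrow> u < t \<Longrightarrow> 0 \<le> v u \<bullet> a u" for t
  proof -
    have "0 \<le> \<alpha> * ?k\<^sup>2 * \<tau>\<^sup>2 / 2"
      using alpha_pos by simp
    moreover have "\<phi> (x t) + \<alpha> * (\<tau> * ?k)\<^sup>2 * ln (t / \<tau>) \<le> \<phi> (x \<tau>)"
      using phi_drop_log[OF \<open>0 < \<tau>\<close> small \<open>\<tau> \<le> t\<close> incr] .
    ultimately have "\<alpha> * (\<tau> * ?k)\<^sup>2 * ln (t / \<tau>) \<le> \<phi> z - m"
      using start lower[of "x t"] by linarith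
    also have "\<dots> \<le> G\<^sup>2 / (2 * \<mu>)"
      using PL \<open>0 < \<mu>\<close> by (simp add: field_simps)
    finally have "\<alpha> * (\<tau> * ?k)\<^sup>2 * ln (t / \<tau>) \<le> G\<^sup>2 / (2 * \<mu>)" .
    then have "ln (t / \<tau>) * (\<alpha> * (\<tau> * ?k)\<^sup>2) \<le> G\<^sup>2 / (2 * \<mu>)"
      by (subst mult.commute)
    then have "ln (t / \<tau>) \<le> G\<^sup>2 / (2 * \<mu>) / (\<alpha> * (\<tau> * ?k)\<^sup>2)"
      by (rule mult_imp_le_div_pos[rotated]) (use assms alpha_pos in simp)
    also have "\<dots> = 2 * (\<alpha> + 1)\<^sup>2 / (\<mu> * \<alpha> * \<tau>\<^sup>2)"
    proof -
      have "G\<^sup>2 / (2 * \<mu>) / (\<alpha> * (\<tau> * (G / (2 * c)))\<^sup>2) = 2 * c\<^sup>2 / (\<mu> * \<alpha> * \<tau>\<^sup>2)" for c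
        using \<open>0 < G\<close> by (simp add: power_mult_distrib power_divide)
      then show ?thesis .
    qed
    finally have "exp (ln (t / \<tau>)) \<le> exp (2 * (\<alpha> + 1)\<^sup>2 / (\<mu> * \<alpha> * \<tau>\<^sup>2))"
      by simp
    moreover have "exp (ln (t / \<tau>)) = t / \<tau>"
      using that(1) \<open>0 < \<tau>\<close> by simp
    ultimately show ?thesis
      using \<open>0 < \<tau>\<close> by (simp add: R_def divide_le_eq mult.commute)
  qed
  have "R \<ge> \<tau>"
    using assms alpha_pos by (simp add: R_def)
  \<comment> \<open>Needed because \<open>Inf\<close> of the empty set carries no information. If
    the speed never stopped increasing, \<open>le_R\<close> would apply to R + 1.\<close>
  have "?A \<noteq> {}"
  proof
    assume empty: "?A = {}"
    have "0 \<le> v u \<bullet> a u" if "0 < u" for u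
    proof -
      have "u \<notin> ?A"
        unfolding empty by simp
      with that show ?thesis by simp
    qed
    with le_R[of "R + 1"] \<open>R \<ge> \<tau>\<close> show False by simp
  qed
  have "\<tau> \<le> u" if "u \<in> ?A" for u
  proof (rule ccontr)
    assume "\<not> \<tau> \<le> u"
    with that have "16 * L * u * (u + \<beta>) \<le> 16 * L * \<tau> * (\<tau> + \<beta>)"
      using L_pos beta_pos by (intro mult_mono) auto
    with that small \<open>0 < G\<close> show False
      using speed_increasing_near_start[of u] by auto
  qed
  with \<open>?A \<noteq> {}\<close> show lb: ?lb
    unfolding restart_time_eq by (rule cInf_greatest)
  have incr: "0 \<le> v u \<bullet> a u" if "0 < u" "u < restart_time x" for u
  proof -
    have "bdd_below ?A"
      by (rule bdd_belowI[of _ 0]) auto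
    then have "u \<notin> ?A"
      using that(2) cInf_lower[of u ?A] by (auto simp: restart_time_eq)
    with that(1) show ?thesis by simp
  qed
  with lb show ?ub by (intro le_R)
  show "\<phi> (x t) \<le> \<phi> z" if "0 \<le> t" "t \<le> restart_time x" for t
    using phi_drop[of 0 t "\<lambda>_. 0" "\<lambda>_. 0"] that incr alpha_pos by (simp add: x_0)
  \<comment> \<open>The contraction comes from the loss on [0, \<tau>] alone; from \<tau> to the
    restart only monotonicity is used.\<close>
  have "\<phi> (x (restart_time x)) \<le> \<phi> (x \<tau>)"
    using phi_drop[of \<tau> "restart_time x" "\<lambda>_. 0" "\<lambda>_. 0"] lb incr alpha_pos \<open>0 < \<tau>\<close> by simp
  with start have "\<phi> (x (restart_time x)) - m \<le> (\<phi> z - m) - \<alpha> * ?k\<^sup>2 * \<tau>\<^sup>2 / 2"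
    by simp
  \<comment> \<open>The gradient inequality turns the loss \<alpha> \<tau>^2 G^2 / (8 (\<alpha> +
    1)^2) into a fraction of the gap.\<close>
  also have "\<dots> \<le> (\<phi> z - m) - \<mu> * \<alpha> * \<tau>\<^sup>2 / (4 * (\<alpha> + 1)\<^sup>2) * (\<phi> z - m)"
  proof -
    have "\<alpha> * \<tau>\<^sup>2 / (4 * (\<alpha> + 1)\<^sup>2) * (\<mu> * (\<phi> z - m)) \<le> \<alpha> * \<tau>\<^sup>2 / (4 * (\<alpha> + 1)\<^sup>2) * (1 / 2 * G\<^sup>2)"
      using PL alpha_pos by (intro mult_left_mono) auto
    moreover have "\<alpha> * \<tau>\<^sup>2 / (4 * (\<alpha> + 1)\<^sup>2) * (1 / 2 * G\<^sup>2) = \<alpha> * ?k\<^sup>2 * \<tau>\<^sup>2 / 2"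
    proof -
      have "\<alpha> * \<tau>\<^sup>2 / (4 * c\<^sup>2) * (1 / 2 * G\<^sup>2) = \<alpha> * (G / (2 * c))\<^sup>2 * \<tau>\<^sup>2 / 2" for c
        by (simp add: power_mult_distrib power_divide)
      then show ?thesis .
    qed
    ultimately show ?thesis by (simp add: mult_ac)
  qed
  finally show "\<phi> (x (restart_time x)) - m
      \<le> (1 - \<mu> * \<alpha> * \<tau>\<^sup>2 / (4 * (\<alpha> + 1)\<^sup>2)) * (\<phi> z - m)"
    by (simp add: left_diff_distrib)
qed

end

section \<open>Minimizers and their distance\<close>

lemma min_value_eq:
  fixes \<phi> :: "'a \<Rightarrow> real"
  assumes "p \<in> argmin_set \<phi>"
  shows "min_value \<phi> = \<phi> p"
proof -
  have "\<phi> p \<le> \<phi> u" for u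
    using assms by (auto simp: argmin_set_def is_arg_min_linorder)
  then show ?thesis
    unfolding min_value_def by (intro cInf_eq_minimum) auto
qed

lemma argmin_set_eq:
  fixes \<phi> :: "'a \<Rightarrow> real"
  assumes "argmin_set \<phi> \<noteq> {}"
  shows "argmin_set \<phi> = {u. \<phi> u \<le> min_value \<phi>}" and "min_value \<phi> \<le> \<phi> u"
proof -
  obtain p where p: "p \<in> argmin_set \<phi>"
    using assms by auto
  then have le: "\<phi> p \<le> \<phi> u" for u
    by (auto simp: argmin_set_def is_arg_min_linorder)
  then show "min_value \<phi> \<le> \<phi> u"
    using min_value_eq[OF p] by simp
  show "argmin_set \<phi> = {u. \<phi> u \<le> min_value \<phi>}"
    using le min_value_eq[OF p] by (auto simp: argmin_set_def is_arg_min_linorder intro: order_trans)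
qed

text \<open>The set of minimizers is a closed sublevel set, so a nearest minimizer \<open>p\<close>
  exists. The gradient vanishes there, and the descent lemma based at \<open>p\<close> has only its
  quadratic term left.\<close>

lemma gap_le_infdist:
  fixes \<phi> :: "real ^ 'n \<Rightarrow> real"
  assumes diff: "\<And>x. \<phi> differentiable at x" and lip: "L-lipschitz_on UNIV (grad \<phi>)"
    and ne: "argmin_set \<phi> \<noteq> {}"
  shows "\<phi> x - min_value \<phi> \<le> L / 2 * (infdist x (argmin_set \<phi>))\<^sup>2"
proof -
  have "continuous_on UNIV \<phi>"
    by (simp add: continuous_at_imp_continuous_on differentiable_imp_continuous_within diff)
  then have "closed (argmin_set \<phi>)"
    unfolding argmin_set_eq(1)[OF ne] by (intro closed_Collect_le) auto
  then obtain p where p: "p \<in> argmin_set \<phi>" and dist: "infdist x (argmin_set \<phi>) = dist x p"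
    using infdist_attains_inf[OF _ ne] by blast
  have "grad \<phi> p = 0"
  proof -
    have "(\<phi> has_derivative (\<lambda>h. h \<bullet> grad \<phi> p)) (at p)"
      using GDERIV_grad[OF diff] by (simp add: gderiv_def)
    moreover have "\<forall>y\<in>ball p 1. \<phi> p \<le> \<phi> y"
      using argmin_set_eq(2)[OF ne] min_value_eq[OF p] by auto
    ultimately have "(\<lambda>h. h \<bullet> grad \<phi> p) = (\<lambda>h. 0)"
      by (intro differential_zero_maxmin[of p "ball p 1" \<phi>]) auto
    then show ?thesis
      by (metis inner_eq_zero_iff)
  qed
  then show ?thesis
    using descent_lemma[OF diff lip, of x p] min_value_eq[OF p] dist
    by (simp add: dist_norm)
qed

section \<open>Exponential decay over all restarts\<close>

lemma restarted_trajectory_decay: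
  fixes \<phi> :: "real ^ 'n \<Rightarrow> real" and y :: "real ^ 'n \<Rightarrow> real \<Rightarrow> real ^ 'n"
    and R \<tau> q :: real
  assumes ne: "argmin_set \<phi> \<noteq> {}" and "0 < \<tau>" and "0 < q" and "0 < t"
    and lb: "\<And>z. z \<notin> argmin_set \<phi> \<Longrightarrow> \<tau> \<le> restart_time (y z)"
    and ub: "\<And>z. z \<notin> argmin_set \<phi> \<Longrightarrow> restart_time (y z) \<le> R"
    and decr: "\<And>z s. z \<notin> argmin_set \<phi> \<Longrightarrow> 0 \<le> s \<Longrightarrow> s \<le> restart_time (y z) \<Longrightarrow> \<phi> (y z s) \<le> \<phi> z"
    and contr: "\<And>z. z \<notin> argmin_set \<phi> \<Longrightarrow>
      \<phi> (y z (restart_time (y z))) - min_value \<phi> \<le> exp (- q) * (\<phi> z - min_value \<phi>)"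
  shows "\<phi> (restarted_trajectory \<phi> y x0 t) - min_value \<phi>
    \<le> exp q * exp (- (q / R) * t) * (\<phi> x0 - min_value \<phi>)"
proof -
  let ?x = "restart_point y x0" and ?S = "restart_instant y x0" and ?m = "min_value \<phi>"
  have gap: "0 \<le> \<phi> z - ?m" for z
    using argmin_set_eq(2)[OF ne] by simp
  \<comment> \<open>The induction runs only through nonminimizers, since the hypotheses do not
    control restarting times at minimizers.\<close>
  have seq: "real k * \<tau> \<le> ?S k \<and> ?S k \<le> real k * R \<and> \<phi> (?x k) - ?m \<le> exp (- (q * real k)) * (\<phi> x0 - ?m)"
    if "\<forall>j<k. ?x j \<notin> argmin_set \<phi>" for k
    using that
  proof (induction k)
    case (Suc k)
    then have k: "?x k \<notin> argmin_set \<phi>" by simp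
    have "\<phi> (?x (Suc k)) - ?m \<le> exp (- q) * (\<phi> (?x k) - ?m)"
      using contr[OF k] by simp
    also have "\<dots> \<le> exp (- q) * (exp (- (q * real k)) * (\<phi> x0 - ?m))"
      using Suc by (intro mult_left_mono) auto
    also have "\<dots> = exp (- (q * real (Suc k))) * (\<phi> x0 - ?m)"
      by (simp add: algebra_simps flip: exp_add)
    finally show ?case
      using Suc lb[OF k] ub[OF k] by (simp add: algebra_simps)
  qed simp
  show ?thesis
  proof (cases "\<exists>i. ?x i \<in> argmin_set \<phi> \<and> ?S i \<le> t")
    case True
    let ?i = "LEAST i. ?x i \<in> argmin_set \<phi> \<and> ?S i \<le> t"
    have "?x ?i \<in> argmin_set \<phi>"
      using LeastI_ex[OF True] by simp
    with True have "\<phi> (restarted_trajectory \<phi> y x0 t) = ?m"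
      by (simp add: restarted_trajectory_def min_value_eq)
    with gap[of x0] show ?thesis by simp
  next
    case False
    \<comment> \<open>A minimizer reached at an instant before \<open>t\<close> would put the
      trajectory in its constant branch, which this case excludes.\<close>
    have before: "?S k < t \<and> (\<forall>j\<le>k. ?x j \<notin> argmin_set \<phi>)" if "\<forall>j<k. ?S (Suc j) < t" for k
    proof -
      have S: "?S j < t" if "j \<le> k" for j
        using that \<open>\<forall>j<k. ?S (Suc j) < t\<close> \<open>0 < t\<close> by (cases j) (auto simp del: restart_instant.simps(2))
      with False show ?thesis by force
    qed
    \<comment> \<open>Restart instants grow at least like k \<tau>, so they pass \<open>t\<close>;
      hence the \<open>LEAST\<close> selecting the segment is attained.\<close>
    obtain k where "t \<le> ?S (Suc k)"
    proof (rule ccontr)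
      assume "\<not> thesis"
      then have S: "?S (Suc k) < t" for k
        using that by (meson not_le)
      obtain k where k: "t < real k * \<tau>"
        using reals_Archimedean3[OF \<open>0 < \<tau>\<close>] by blast
      have "?S k < t" "\<forall>j<k. ?x j \<notin> argmin_set \<phi>"
        using before[of k] S by auto
      with seq[of k] k show False by simp
    qed
    define i where "i = (LEAST i. t \<le> ?S (Suc i))"
    have i: "t \<le> ?S (Suc i)"
      unfolding i_def using \<open>t \<le> ?S (Suc k)\<close> by (rule LeastI)
    have "\<forall>j<i. ?S (Suc j) < t"
      using not_less_Least[of _ "\<lambda>i. t \<le> ?S (Suc i)"] unfolding i_def by (meson not_le)
    from before[OF this] have S: "?S i < t" and nonmin: "\<forall>j\<le>i. ?x j \<notin> argmin_set \<phi>"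
      by auto
    have "restarted_trajectory \<phi> y x0 t = y (?x i) (t - ?S i)"
      unfolding restarted_trajectory_def if_not_P[OF False] Let_def i_def by (rule refl)
    moreover have "\<phi> (y (?x i) (t - ?S i)) \<le> \<phi> (?x i)"
      using nonmin S i by (intro decr) auto
    moreover have "\<phi> (?x i) - ?m \<le> exp (- (q * real i)) * (\<phi> x0 - ?m)"
      using seq[of i] nonmin by simp
    \<comment> \<open>Segment \<open>i\<close> ends by (i + 1) R, so i \<ge> t/R - 1; the factor
      \<open>exp q\<close> pays for the unfinished segment.\<close>
    moreover have "exp (- (q * real i)) \<le> exp q * exp (- (q / R) * t)"
    proof -
      have "t \<le> real (Suc i) * R"
        using seq[of "Suc i"] nonmin i by (simp add: less_Suc_eq_le)
      moreover have "0 < R"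
        using lb[of "?x i"] ub[of "?x i"] nonmin \<open>0 < \<tau>\<close> by force
      ultimately have "q * (t / R) \<le> q * real (Suc i)"
        using \<open>0 < q\<close> by (intro mult_left_mono) (auto simp: divide_le_eq)
      then show ?thesis
        by (simp add: algebra_simps flip: exp_add)
    qed
    ultimately show ?thesis
      using mult_right_mono[OF _ gap[of x0]] by fastforce
  qed
qed

theorem theorem2p5:
  fixes \<phi> :: "real ^ 'n \<Rightarrow> real"
    and \<alpha> \<beta> L \<mu> :: real
    and y :: "real ^ 'n \<Rightarrow> real \<Rightarrow> real ^ 'n"
    and x0 :: "real ^ 'n"
  assumes "convex_on UNIV \<phi>"
    and "twice_continuously_differentiable \<phi>"
    and "L > 0" and "L-lipschitz_on UNIV (grad \<phi>)"
    and "argmin_set \<phi> \<noteq> {}"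
    and "\<mu> > 0" and "\<And>z. \<mu> * (\<phi> z - min_value \<phi>) \<le> 1/2 * (norm (grad \<phi> z))\<^sup>2"
    and "\<alpha> \<ge> 3" and "\<beta> > 0"
    and "\<And>z. is_solution \<phi> \<alpha> \<beta> z (y z)"
  shows "\<exists>C K. C > 0 \<and> K > 0 \<and>
    (\<forall>t>0.
      \<phi> (restarted_trajectory \<phi> y x0 t) - min_value \<phi>
        \<le> C * exp (- K * t) * (\<phi> x0 - min_value \<phi>) \<and>
      C * exp (- K * t) * (\<phi> x0 - min_value \<phi>)
        \<le> C * L / 2 * exp (- K * t) * (infdist x0 (argmin_set \<phi>))\<^sup>2)"
proof -
  let ?m = "min_value \<phi>"
  \<comment> \<open>The bound 1 gives \<tau> + \<beta> \<le> 1 + \<beta>; the other bound then gives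
    the window condition.\<close>
  define \<tau> where "\<tau> = min 1 (1 / (16 * L * (1 + \<beta>)))"
  define R where "R = \<tau> * exp (2 * (\<alpha> + 1)\<^sup>2 / (\<mu> * \<alpha> * \<tau>\<^sup>2))"
  define q where "q = \<mu> * \<alpha> * \<tau>\<^sup>2 / (4 * (\<alpha> + 1)\<^sup>2)"
  have \<tau>: "0 < \<tau>"
    using assms(3,9) by (simp add: \<tau>_def)
  have small: "16 * L * \<tau> * (\<tau> + \<beta>) \<le> 1"
  proof -
    have "16 * L * \<tau> * (\<tau> + \<beta>) \<le> 16 * L * (1 / (16 * L * (1 + \<beta>))) * (1 + \<beta>)"
      using assms(3,9) \<tau> by (intro mult_mono mult_left_mono) (auto simp: \<tau>_def)
    also have "\<dots> = 1"
      using assms(3,9) by simp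
    finally show ?thesis .
  qed
  have "0 < R"
    using \<tau> by (simp add: R_def)
  have "0 < q"
    using \<tau> assms(6,8) by (simp add: q_def)
  have gap: "0 \<le> \<phi> z - ?m" for z
    using argmin_set_eq(2)[OF assms(5)] by simp
  have bounds: "\<tau> \<le> restart_time (y z)" "restart_time (y z) \<le> R"
    "\<And>s. 0 \<le> s \<Longrightarrow> s \<le> restart_time (y z) \<Longrightarrow> \<phi> (y z s) \<le> \<phi> z"
    "\<phi> (y z (restart_time (y z))) - ?m \<le> exp (- q) * (\<phi> z - ?m)"
    if "z \<notin> argmin_set \<phi>" for z
  proof -
    interpret hessian_damped_solution \<phi> \<alpha> \<beta> L z "y z"
      using assms by unfold_locales auto
    \<comment> \<open>Off the minimizers the gap is positive, and the gradient inequality then makes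
      the gradient nonzero.\<close>
    have "0 < \<phi> z - ?m"
      using that argmin_set_eq(1)[OF assms(5)] by auto
    then have "0 < \<mu> * (\<phi> z - ?m)"
      using assms(6) by simp
    then have "0 < (norm (grad \<phi> z))\<^sup>2"
      using assms(7)[of z] by linarith
    then have G: "0 < norm (grad \<phi> z)" by simp
    note b = restart_time_bounds[OF \<tau> small G assms(6,7) argmin_set_eq(2)[OF assms(5)],
        folded R_def q_def]
    show "\<tau> \<le> restart_time (y z)" "restart_time (y z) \<le> R"
      "\<And>s. 0 \<le> s \<Longrightarrow> s \<le> restart_time (y z) \<Longrightarrow> \<phi> (y z s) \<le> \<phi> z"
      using b(1-3) by auto
    note b(4)
    \<comment> \<open>Passing from 1 - q to \<open>exp (- q)\<close> makes the rate a logarithm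
      without checking that q < 1.\<close>
    also have "(1 - q) * (\<phi> z - ?m) \<le> exp (- q) * (\<phi> z - ?m)"
      using gap[of z] exp_ge_add_one_self[of "- q"] by (intro mult_right_mono) auto
    finally show "\<phi> (y z (restart_time (y z))) - ?m \<le> exp (- q) * (\<phi> z - ?m)" .
  qed
  have diff: "\<phi> differentiable at x" for x
    using assms(2) by (auto simp: twice_continuously_differentiable_def differentiable_on_def)
  show ?thesis
  \<comment> \<open>The witnesses, read off from the two inequalities below, are C =
    \<open>exp q\<close> and K = q / R; neither depends on \<open>x0\<close>.\<close>
  proof (intro exI conjI allI impI)
    fix t :: real
    assume "0 < t"
    show "\<phi> (restarted_trajectory \<phi> y x0 t) - ?m \<le> exp q * exp (- (q / R) * t) * (\<phi> x0 - ?m)"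
      by (rule restarted_trajectory_decay[OF assms(5) \<tau> \<open>0 < q\<close> \<open>0 < t\<close> bounds])
    show "exp q * exp (- (q / R) * t) * (\<phi> x0 - ?m)
        \<le> exp q * L / 2 * exp (- (q / R) * t) * (infdist x0 (argmin_set \<phi>))\<^sup>2"
      using mult_left_mono[OF gap_le_infdist[OF diff assms(4,5), of x0],
          of "exp q * exp (- (q / R) * t)"]
      by (simp add: mult_ac)
  qed (use \<open>0 < q\<close> \<open>0 < R\<close> in auto)
qed

end
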